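(* Let $X$ be a proper, geodesically complete $CAT(-1)$ metric space, let $\Gamma$ be a countable non-elementary, properly discontinuous group of isometries of $X$, let $F:T^1X\to\mathbb{R}$ be a continuous $\Gamma$-invariant potential satisfying the Hölder-control (HC) property with $v_F<\infty$, and let $\mu$ be a probability measure on $\Gamma$ with finite exponential moment whose support generates $\Gamma$ as a semigroup. Then $$h_\mu\le\ell_\mu v_F-\ell_{F,\mu}.$$
   Context: $T^1X$ is the unit tangent bundle of $X$: the space of germs at time $0$ of unit-speed bi-infinite geodesics $\mathbb{R}\to X$ (two geodesics having the same germ if they agree on some $[-\epsilon,\epsilon]$), with $\pi:T^1X\to X$ the footpoint projection. For $x,y\in X$, $d_F(x,y)=\int_x^yF\,dt$ is the integral of $F$ along (the germs of) the unit-speed geodesic from $x$ to $y$. (HC) property: (a) there exist $c_1>0$, $c_2\in(0,1)$ such that for all $x,y,x',y'\in X$ with $d(x,x'),d(y,y')\le1$, $$\Big|\int_{x'}^{y'}F\,dt-\int_x^yF\,dt\Big|\le\Big(c_1+\max_{\pi^{-1}(B(x,d(x,x')))}|F|\Big)d(x,x')^{c_2}+\Big(c_1+\max_{\pi^{-1}(B(y,d(y,y')))}|F|\Big)d(y,y')^{c_2};$$ (b) for each $a>1$ there is $b>0$ with $|F(u)-F(w)|\le b\,a^{d(\pi(u),\pi(w))}$ for all $u,w\in T^1X$. Fix $o\in X$. The topological pressure is $v_F=\limsup_{n\to\infty}\frac1n\log\sum_{g\in\Gamma:\,n-1\le d(o,go)\le n}e^{d_F(o,go)}$. Finite exponential moment: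 $\sum_ge^{t\,d(o,go)}\mu(g)<\infty$ for some $t>0$. With $\omega_n=g_1\cdots g_n$, $g_i$ i.i.d. of law $\mu$: $h_\mu=\lim_n\frac1n\sum_g-\mu^{*n}(g)\log\mu^{*n}(g)$, $\ell_\mu=\lim_n\frac1nd(o,\omega_no)$ and $\ell_{F,\mu}=\lim_n\frac1nd_F(o,\omega_no)$, the last two limits existing a.s. and being constant. *)

theory Defs
  imports "HOL-Probability.Probability" "HOL-Algebra.Bij"
begin

text \<open>The space \<open>X\<close> is a whole type \<open>'x\<close>. Properness is the type class
  \<open>heine_borel\<close> (bounded sequences have convergent subsequences).\<close>

section \<open>Geodesics and the CAT(-1) condition\<close>

definition geodesic_path :: "(real \<Rightarrow> 'x::metric_space) \<Rightarrow> 'x \<Rightarrow> 'x \<Rightarrow> bool" where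
  "geodesic_path c x y \<longleftrightarrow> c 0 = x \<and> c (dist x y) = y \<and>
     (\<forall>s\<in>{0..dist x y}. \<forall>t\<in>{0..dist x y}. dist (c s) (c t) = \<bar>s - t\<bar>)"

definition geodesic_lines :: "(real \<Rightarrow> 'x::metric_space) set" where
  "geodesic_lines = {c. \<forall>s t. dist (c s) (c t) = \<bar>s - t\<bar>}"

definition geodesic_space :: "'x::metric_space itself \<Rightarrow> bool" where
  "geodesic_space _ \<longleftrightarrow> (\<forall>x y :: 'x. \<exists>c. geodesic_path c x y)"

definition geodesically_complete :: "'x::metric_space itself \<Rightarrow> bool" where
  "geodesically_complete _ \<longleftrightarrow>
     (\<forall>(x::'x) y c. x \<noteq> y \<and> geodesic_path c x y \<longrightarrow>
        (\<exists>c'\<in>geodesic_lines. \<forall>t\<in>{0..dist x y}. c' t = c t))"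

text \<open>The comparison space is the hyperbolic plane of curvature -1, in the upper half-plane
  model.\<close>

definition hyp_plane :: "complex set" where
  "hyp_plane = {z. Im z > 0}"

definition hyp_dist :: "complex \<Rightarrow> complex \<Rightarrow> real" where
  "hyp_dist z w = arcosh (1 + (cmod (z - w))\<^sup>2 / (2 * Im z * Im w))"

text \<open>Two sides of a geodesic triangle always share a vertex, called \<open>x\<close> here, and points on the
  same side satisfy the comparison inequality trivially. So it is enough to compare a point
  \<open>c s\<close> of a side \<open>[x, y]\<close> and a point \<open>c' t\<close> of a side \<open>[x, z]\<close> with their comparison points
  \<open>p'\<close> and \<open>q'\<close>. The third side enters through its length only.\<close>

definition CAT_minus_one :: "'x::metric_space itself \<Rightarrow> bool" where
  "CAT_minus_one T \<longleftrightarrow> geodesic_space T \<and>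
     (\<forall>(x::'x) y z c c'. geodesic_path c x y \<and> geodesic_path c' x z \<longrightarrow>
       (\<forall>x'\<in>hyp_plane. \<forall>y'\<in>hyp_plane. \<forall>z'\<in>hyp_plane.
          hyp_dist x' y' = dist x y \<and> hyp_dist x' z' = dist x z \<and> hyp_dist y' z' = dist y z \<longrightarrow>
          (\<forall>s\<in>{0..dist x y}. \<forall>t\<in>{0..dist x z}. \<forall>p'\<in>hyp_plane. \<forall>q'\<in>hyp_plane.
             hyp_dist x' p' = s \<and> hyp_dist p' y' = dist x y - s \<and>
             hyp_dist x' q' = t \<and> hyp_dist q' z' = dist x z - t \<longrightarrow>
             dist (c s) (c' t) \<le> hyp_dist p' q')))"

section \<open>The unit tangent bundle\<close>

definition germ_rel :: "((real \<Rightarrow> 'x::metric_space) \<times> (real \<Rightarrow> 'x)) set" where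
  "germ_rel = {(c, c'). c \<in> geodesic_lines \<and> c' \<in> geodesic_lines \<and>
     (\<exists>\<epsilon>>0. \<forall>t\<in>{-\<epsilon>..\<epsilon>}. c t = c' t)}"

definition germ :: "(real \<Rightarrow> 'x::metric_space) \<Rightarrow> (real \<Rightarrow> 'x) set" where
  "germ c = germ_rel `` {c}"

definition unit_tangent :: "(real \<Rightarrow> 'x::metric_space) set set" where
  "unit_tangent = geodesic_lines // germ_rel"

definition footpoint :: "(real \<Rightarrow> 'x::metric_space) set \<Rightarrow> 'x" where
  "footpoint u = the_elem ((\<lambda>c. c 0) ` u)"

definition compact_open_topology :: "(real \<Rightarrow> 'x::metric_space) topology" where
  "compact_open_topology =
     topology_generated_by {{c \<in> geodesic_lines. c ` K \<subseteq> U} | K U. compact K \<and> open U}"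

text \<open>The bundle carries the quotient topology.\<close>

definition unit_tangent_topology :: "(real \<Rightarrow> 'x::metric_space) set topology" where
  "unit_tangent_topology = topology (\<lambda>V. V \<subseteq> unit_tangent \<and>
     openin compact_open_topology {c \<in> geodesic_lines. germ c \<in> V})"

lemma openin_unit_tangent_topology:
  "openin unit_tangent_topology V \<longleftrightarrow> V \<subseteq> unit_tangent \<and>
     openin compact_open_topology {c \<in> geodesic_lines. germ c \<in> V}"
proof -
  have "istopology (\<lambda>V. V \<subseteq> unit_tangent \<and>
      openin compact_open_topology {c \<in> geodesic_lines :: (real \<Rightarrow> 'a) set. germ c \<in> V})"
    unfolding istopology_def
  proof (intro conjI allI impI)
    fix S T :: "(real \<Rightarrow> 'a) set set"
    assume S: "S \<subseteq> unit_tangent \<and> openin compact_open_topology {c \<in> geodesic_lines. germ c \<in> S}"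
      and T: "T \<subseteq> unit_tangent \<and> openin compact_open_topology {c \<in> geodesic_lines. germ c \<in> T}"
    then show "S \<inter> T \<subseteq> unit_tangent" by blast
    have "{c \<in> geodesic_lines. germ c \<in> S \<inter> T} =
        {c \<in> geodesic_lines. germ c \<in> S} \<inter> {c \<in> geodesic_lines. germ c \<in> T}" by blast
    moreover have "openin compact_open_topology
        ({c \<in> geodesic_lines. germ c \<in> S} \<inter> {c \<in> geodesic_lines. germ c \<in> T})"
      by (rule openin_Int[OF conjunct2[OF S] conjunct2[OF T]])
    ultimately show "openin compact_open_topology {c \<in> geodesic_lines. germ c \<in> S \<inter> T}"
      by (simp only:)
  next
    fix \<K> :: "(real \<Rightarrow> 'a) set set set"
    assume K: "\<forall>K\<in>\<K>. K \<subseteq> unit_tangent \<and>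
      openin compact_open_topology {c \<in> geodesic_lines. germ c \<in> K}"
    then show "\<Union>\<K> \<subseteq> unit_tangent" by blast
    have "{c \<in> geodesic_lines. germ c \<in> \<Union>\<K>} = (\<Union>K\<in>\<K>. {c \<in> geodesic_lines. germ c \<in> K})" by blast
    moreover have "openin compact_open_topology (\<Union>K\<in>\<K>. {c \<in> geodesic_lines. germ c \<in> K})"
      by (rule openin_Union) (use K in blast)
    ultimately show "openin compact_open_topology {c \<in> geodesic_lines. germ c \<in> \<Union>\<K>}"
      by (simp only:)
  qed
  then show ?thesis
    unfolding unit_tangent_topology_def by (subst topology_inverse') simp_all
qed

section \<open>Potentials\<close>

text \<open>The geodesic from \<open>x\<close> to \<open>y\<close> is extended to a line \<open>c\<close>, whose germ at time \<open>t\<close> is the germ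
  at \<open>0\<close> of \<open>\<lambda>s. c (t + s)\<close>. In a geodesically complete CAT(-1) space such a \<open>c\<close> exists, and
  another extension changes the integrand at the two endpoints only.\<close>

definition dF :: "((real \<Rightarrow> 'x::metric_space) set \<Rightarrow> real) \<Rightarrow> 'x \<Rightarrow> 'x \<Rightarrow> real" where
  "dF F x y = (let c = (SOME c. c \<in> geodesic_lines \<and> c 0 = x \<and> c (dist x y) = y)
               in integral {0..dist x y} (\<lambda>t. F (germ (\<lambda>s. c (t + s)))))"

text \<open>The balls \<open>B(x, r)\<close> in the (HC) property are closed, so for continuous \<open>F\<close> the supremum
  is a maximum over a compact set.\<close>

definition max_over_ball ::
    "((real \<Rightarrow> 'x::metric_space) set \<Rightarrow> real) \<Rightarrow> 'x \<Rightarrow> real \<Rightarrow> real" where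
  "max_over_ball F x r = (SUP u\<in>{u \<in> unit_tangent. footpoint u \<in> cball x r}. \<bar>F u\<bar>)"

definition Holder_control :: "((real \<Rightarrow> 'x::metric_space) set \<Rightarrow> real) \<Rightarrow> bool" where
  "Holder_control F \<longleftrightarrow>
     (\<exists>c1>0. \<exists>c2. 0 < c2 \<and> c2 < 1 \<and>
        (\<forall>x y x' y'. dist x x' \<le> 1 \<and> dist y y' \<le> 1 \<longrightarrow>
           \<bar>dF F x' y' - dF F x y\<bar> \<le>
             (c1 + max_over_ball F x (dist x x')) * dist x x' powr c2 +
             (c1 + max_over_ball F y (dist y y')) * dist y y' powr c2)) \<and>
     (\<forall>a>1. \<exists>b>0. \<forall>u\<in>unit_tangent. \<forall>w\<in>unit_tangent.
        \<bar>F u - F w\<bar> \<le> b * a powr dist (footpoint u) (footpoint w))"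

definition invariant_potential ::
    "('x \<Rightarrow> 'x) set \<Rightarrow> ((real \<Rightarrow> 'x::metric_space) set \<Rightarrow> real) \<Rightarrow> bool" where
  "invariant_potential \<Gamma> F \<longleftrightarrow> (\<forall>g\<in>\<Gamma>. \<forall>u\<in>unit_tangent. F ((\<lambda>c. g \<circ> c) ` u) = F u)"

section \<open>Groups of isometries\<close>

definition isometry_group :: "('x::metric_space \<Rightarrow> 'x) set \<Rightarrow> bool" where
  "isometry_group \<Gamma> \<longleftrightarrow> subgroup \<Gamma> (BijGroup UNIV) \<and>
     (\<forall>g\<in>\<Gamma>. \<forall>x y. dist (g x) (g y) = dist x y)"

definition properly_discontinuous :: "('x::metric_space \<Rightarrow> 'x) set \<Rightarrow> bool" where
  "properly_discontinuous \<Gamma> \<longleftrightarrow> (\<forall>K. compact K \<longrightarrow> finite {g \<in> \<Gamma>. g ` K \<inter> K \<noteq> {}})"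

definition gromov_product :: "'x::metric_space \<Rightarrow> 'x \<Rightarrow> 'x \<Rightarrow> real" where
  "gromov_product x0 x y = (dist x0 x + dist x0 y - dist x y) / 2"

definition gromov_sequences :: "'x::metric_space \<Rightarrow> (nat \<Rightarrow> 'x) set" where
  "gromov_sequences x0 = {u. filterlim (\<lambda>(i, j). gromov_product x0 (u i) (u j)) at_top
     (sequentially \<times>\<^sub>F sequentially)}"

definition gromov_rel :: "'x::metric_space \<Rightarrow> ((nat \<Rightarrow> 'x) \<times> (nat \<Rightarrow> 'x)) set" where
  "gromov_rel x0 = {(u, v). u \<in> gromov_sequences x0 \<and> v \<in> gromov_sequences x0 \<and>
     filterlim (\<lambda>(i, j). gromov_product x0 (u i) (v j)) at_top (sequentially \<times>\<^sub>F sequentially)}"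

definition gromov_boundary :: "'x::metric_space \<Rightarrow> (nat \<Rightarrow> 'x) set set" where
  "gromov_boundary x0 = gromov_sequences x0 // gromov_rel x0"

definition limit_set :: "('x::metric_space \<Rightarrow> 'x) set \<Rightarrow> 'x \<Rightarrow> (nat \<Rightarrow> 'x) set set" where
  "limit_set \<Gamma> x0 = {\<xi> \<in> gromov_boundary x0. \<exists>u\<in>\<xi>. range u \<subseteq> (\<lambda>g. g x0) ` \<Gamma>}"

text \<open>The basepoint is only a choice of representation: neither divergence nor equivalence of
  sequences depends on it, and orbits of different points have the same limit points.\<close>

definition non_elementary :: "('x::metric_space \<Rightarrow> 'x) set \<Rightarrow> 'x \<Rightarrow> bool" where
  "non_elementary \<Gamma> x0 \<longleftrightarrow> infinite (limit_set \<Gamma> x0) \<or> card (limit_set \<Gamma> x0) \<ge> 3"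

text \<open>The pressure is extended-real valued, with \<open>log 0 = -\<infinity>\<close> for empty annuli. The index sets
  are finite when \<open>\<Gamma>\<close> acts properly discontinuously on a proper space.\<close>

definition pressure ::
    "('x \<Rightarrow> 'x) set \<Rightarrow> ((real \<Rightarrow> 'x::metric_space) set \<Rightarrow> real) \<Rightarrow> 'x \<Rightarrow> ereal" where
  "pressure \<Gamma> F x0 = limsup (\<lambda>n::nat.
     let A = {g \<in> \<Gamma>. real n - 1 \<le> dist x0 (g x0) \<and> dist x0 (g x0) \<le> real n}
     in if A = {} then - \<infinity> else ereal (1 / real n * ln (\<Sum>g\<in>A. exp (dF F x0 (g x0)))))"

section \<open>Random walks\<close>

inductive_set semigroup_generated :: "('x \<Rightarrow> 'x) set \<Rightarrow> ('x \<Rightarrow> 'x) set" for S where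
  gen: "g \<in> S \<Longrightarrow> g \<in> semigroup_generated S"
| mult: "g \<in> semigroup_generated S \<Longrightarrow> h \<in> semigroup_generated S \<Longrightarrow>
    g \<circ> h \<in> semigroup_generated S"

definition finite_exponential_moment :: "('x::metric_space \<Rightarrow> 'x) pmf \<Rightarrow> 'x \<Rightarrow> bool" where
  "finite_exponential_moment \<mu> x0 \<longleftrightarrow>
     (\<exists>t>0. (\<lambda>g. exp (t * dist x0 (g x0)) * pmf \<mu> g) summable_on set_pmf \<mu>)"

primrec conv_power :: "('x \<Rightarrow> 'x) pmf \<Rightarrow> nat \<Rightarrow> ('x \<Rightarrow> 'x) pmf" where
  "conv_power \<mu> 0 = return_pmf id"
| "conv_power \<mu> (Suc n) = map_pmf (\<lambda>(g, h). g \<circ> h) (pair_pmf (conv_power \<mu> n) \<mu>)"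

text \<open>Entropy takes values in \<open>[0, \<infinity>]\<close>, so the sum is always meaningful.\<close>

definition shannon_entropy :: "'g pmf \<Rightarrow> ennreal" where
  "shannon_entropy p = (\<Sum>\<^sub>\<infinity>g\<in>set_pmf p. ennreal (- pmf p g * ln (pmf p g)))"

definition walk_entropy :: "('x \<Rightarrow> 'x) pmf \<Rightarrow> ereal" where
  "walk_entropy \<mu> = lim (\<lambda>n. enn2ereal (shannon_entropy (conv_power \<mu> n)) / ereal (real n))"

text \<open>\<open>walk g n = g\<^sub>1 \<cdots> g\<^sub>n\<close> for a sequence of increments \<open>g\<close>, indexed from \<open>0\<close>.\<close>

primrec walk :: "(nat \<Rightarrow> 'x \<Rightarrow> 'x) \<Rightarrow> nat \<Rightarrow> 'x \<Rightarrow> 'x" where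
  "walk g 0 = id"
| "walk g (Suc n) = walk g n \<circ> g n"

definition iid_increments :: "('x \<Rightarrow> 'x) pmf \<Rightarrow> (nat \<Rightarrow> 'x \<Rightarrow> 'x) measure" where
  "iid_increments \<mu> = PiM UNIV (\<lambda>_. measure_pmf \<mu>)"

text \<open>\<open>l\<close> is the almost sure, constant limit \<open>l\<^sub>\<mu>\<close>, respectively \<open>l\<^sub>F\<^sub>,\<^sub>\<mu>\<close>.\<close>

definition is_drift :: "('x::metric_space \<Rightarrow> 'x) pmf \<Rightarrow> 'x \<Rightarrow> real \<Rightarrow> bool" where
  "is_drift \<mu> x0 l \<longleftrightarrow>
     (AE g in iid_increments \<mu>. (\<lambda>n. 1 / real n * dist x0 (walk g n x0)) \<longlonglongrightarrow> l)"

definition is_F_drift ::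
    "((real \<Rightarrow> 'x::metric_space) set \<Rightarrow> real) \<Rightarrow> ('x \<Rightarrow> 'x) pmf \<Rightarrow> 'x \<Rightarrow> real \<Rightarrow> bool" where
  "is_F_drift F \<mu> x0 l \<longleftrightarrow>
     (AE g in iid_increments \<mu>. (\<lambda>n. 1 / real n * dF F x0 (walk g n x0)) \<longlonglongrightarrow> l)"

end

theory Submission
  imports Defs
begin

text \<open>
  For \<open>s\<close> above the pressure, the weight \<open>w(g) = exp (d\<^sub>F(o, g o) - s d(o, g
  o))\<close> is summable over the group. Gibbs' inequality compares the law
  \<open>\<mu>\<^sup>*\<^sup>n\<close> of \<open>\<omega>\<^sub>n\<close> with this weight: the entropy
  is at most the mean of \<open>- ln w(\<omega>\<^sub>n) = s d(o, \<omega>\<^sub>n o) - d\<^sub>F(o,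
  \<omega>\<^sub>n o)\<close> up to a constant. That mean should be close to \<open>n (s l -
  l\<^sub>F)\<close>, and letting \<open>s\<close> decrease to the pressure yields the theorem.

  The drifts are almost sure limits, and convergence of \<open>d\<^sub>F(o, \<omega>\<^sub>n o) /
  n\<close> in mean would be a further problem, as \<open>d\<^sub>F\<close> is not subadditive. It is
  bypassed by using Gibbs' inequality only on the set, of probability close to \<open>1\<close>, where
  both quantities are close to their limits (\<open>gibbs_inequality\<close>). The rest of the entropy is
  negligible by uniform integrability of the information \<open>- ln
  \<mu>\<^sup>*\<^sup>n(\<omega>\<^sub>n)\<close>, which is dominated by a sum of independent copies of
  \<open>- ln \<mu>(g)\<close> (\<open>entropy_excess_conv_power\<close>). All of this is carried out in
  \<open>entropy_rate_le\<close>.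

  What it needs is that \<open>\<mu>\<close> has finite entropy. This is not automatic, since the orbit
  may grow faster than exponentially, but it follows by comparing \<open>\<mu>\<close> itself with
  \<open>w\<close> (\<open>finite_shannon_entropy\<close>): part (b) of the Hoelder control bounds
  \<open>|d\<^sub>F(o, g o)|\<close> by a multiple of \<open>exp (t d(o, g o))\<close> for every \<open>t
  > 0\<close> (\<open>dF_exp_bound\<close>), so the exponential moment makes the mean of \<open>- ln
  w\<close> finite.
\<close>

section \<open>Sums and integrals over discrete spaces\<close>

text \<open>Shannon entropy is an unordered sum, while independence is exploited through integrals, hence
  the need to pass between the two.\<close>
lemma infsum_ennreal_eq_nn_integral:
  fixes f :: "'a \<Rightarrow> ennreal"
  assumes "countable A"
  shows "(\<Sum>\<^sub>\<infinity>x\<in>A. f x) = (\<integral>\<^sup>+x. f x \<partial>count_space A)"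
proof (cases "finite A")
  case True
  then show ?thesis by (simp add: nn_integral_count_space_finite)
next
  case False
  let ?e = "from_nat_into A"
  have bij: "bij_betw ?e UNIV A"
    using assms False by (rule bij_betw_from_nat_into)
  have "((\<lambda>n. f (?e n)) has_sum (\<Sum>\<^sub>\<infinity>n. f (?e n))) UNIV"
    by (intro has_sum_infsum nonneg_summable_on_complete) simp
  then have "(\<lambda>n. f (?e n)) sums (\<Sum>\<^sub>\<infinity>n. f (?e n))"
    by (rule has_sum_imp_sums)
  then have "(\<Sum>\<^sub>\<infinity>n. f (?e n)) = (\<integral>\<^sup>+n. f (?e n) \<partial>count_space UNIV)"
    by (simp add: nn_integral_count_space_nat sums_iff)
  then show ?thesis
    by (simp add: infsum_reindex_bij_betw[OF bij] nn_integral_bij_count_space[OF bij])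
qed

lemma infsum_ennreal_of_summable:
  fixes f :: "'a \<Rightarrow> real"
  assumes "f summable_on A" "\<And>x. x \<in> A \<Longrightarrow> 0 \<le> f x"
  shows "(\<Sum>\<^sub>\<infinity>x\<in>A. ennreal (f x)) = ennreal (infsum f A)"
proof -
  have "(\<Sum>\<^sub>\<infinity>x\<in>A. ennreal (f x)) = (SUP F\<in>{F. finite F \<and> F \<subseteq> A}. \<Sum>x\<in>F. ennreal (f x))"
    by (rule nonneg_infsum_complete) simp
  also have "\<dots> = (SUP F\<in>{F. finite F \<and> F \<subseteq> A}. ennreal (sum f F))"
    using assms(2) by (intro SUP_cong refl sum_ennreal) auto
  also have "\<dots> = ennreal (infsum f A)"
    by (rule infsum_nonneg_is_SUPREMUM_ennreal[symmetric]) (use assms in auto)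
  finally show ?thesis .
qed

lemma nn_integral_count_space_mono_set:
  assumes "A \<subseteq> B"
  shows "(\<integral>\<^sup>+x. f x \<partial>count_space A) \<le> (\<integral>\<^sup>+x. f x \<partial>count_space B)"
proof -
  have ind: "(\<integral>\<^sup>+x. f x \<partial>count_space C) = (\<integral>\<^sup>+x. f x * indicator C x \<partial>count_space UNIV)" for C
    by (cases "C = UNIV") (simp_all add: nn_integral_count_space_indicator)
  show ?thesis
    unfolding ind[of A] ind[of B]
    by (rule nn_integral_mono) (use assms in \<open>auto split: split_indicator\<close>)
qed

lemma ennreal_add_le: "ennreal (a + b) \<le> ennreal a + ennreal b"
  by (cases "0 \<le> a"; cases "0 \<le> b")
     (auto simp: ennreal_neg intro!: ennreal_leI simp flip: ennreal_plus)

lemma nn_integral_pmf_cong: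
  assumes "\<And>x. x \<in> set_pmf p \<Longrightarrow> f x = g x"
  shows "(\<integral>\<^sup>+x. f x \<partial>measure_pmf p) = (\<integral>\<^sup>+x. g x \<partial>measure_pmf p)"
  by (rule nn_integral_cong_AE) (simp add: AE_measure_pmf_iff assms)

lemma nn_integral_pmf_mono:
  assumes "\<And>x. x \<in> set_pmf p \<Longrightarrow> f x \<le> g x"
  shows "(\<integral>\<^sup>+x. f x \<partial>measure_pmf p) \<le> (\<integral>\<^sup>+x. g x \<partial>measure_pmf p)"
  by (rule nn_integral_mono_AE) (simp add: AE_measure_pmf_iff assms)

lemma nn_integral_pmf_eq_count_space:
  "(\<integral>\<^sup>+x. f x \<partial>measure_pmf p) = (\<integral>\<^sup>+x. ennreal (pmf p x) * f x \<partial>count_space (set_pmf p))"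
  unfolding nn_integral_measure_pmf
  by (subst nn_integral_count_space_indicator)
     (auto intro!: nn_integral_cong simp: indicator_def set_pmf_iff)

section \<open>Truncated information and the inequality of Gibbs\<close>

text \<open>The mean of the part of the information \<open>- ln (pmf p x)\<close> above the level
  \<open>M\<close>; the embedding \<open>ennreal\<close> truncates negative numbers to \<open>0\<close>.
  Level \<open>0\<close> gives Shannon entropy, and higher levels measure how uniformly integrable the
  information is.\<close>
definition entropy_excess :: "'a pmf \<Rightarrow> real \<Rightarrow> ennreal" where
  "entropy_excess p M = (\<integral>\<^sup>+x. ennreal (- ln (pmf p x) - M) \<partial>p)"

lemma shannon_entropy_eq_entropy_excess: "shannon_entropy p = entropy_excess p 0"
proof -
  have "shannon_entropy p = (\<integral>\<^sup>+x. ennreal (- pmf p x * ln (pmf p x)) \<partial>count_space (set_pmf p))"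
    unfolding shannon_entropy_def by (rule infsum_ennreal_eq_nn_integral) simp
  also have "\<dots> = entropy_excess p 0"
    unfolding entropy_excess_def nn_integral_pmf_eq_count_space
    by (intro nn_integral_cong) (simp flip: ennreal_mult')
  finally show ?thesis .
qed

text \<open>The fibre of \<open>f\<close> over \<open>f x\<close> contains \<open>x\<close>.\<close>
lemma pmf_map_ge: "pmf p x \<le> pmf (map_pmf f p) (f x)"
proof -
  have "measure p {x} \<le> measure p (f -` {f x})"
    by (rule measure_pmf.finite_measure_mono) auto
  then show ?thesis by (simp add: pmf_map measure_pmf_single)
qed

text \<open>A product of two independent elements carries at most the sum of their informations, because
  the pair is one of the ways to obtain the product. Positive parts are subadditive, so this survives
  truncation as long as the levels are added as well.\<close>
lemma entropy_excess_map_pair: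
  "entropy_excess (map_pmf f (pair_pmf p q)) (M + N) \<le> entropy_excess p M + entropy_excess q N"
proof -
  have "entropy_excess (map_pmf f (pair_pmf p q)) (M + N)
      \<le> (\<integral>\<^sup>+z. ennreal (- ln (pmf p (fst z)) - M) + ennreal (- ln (pmf q (snd z)) - N) \<partial>pair_pmf p q)"
    unfolding entropy_excess_def nn_integral_map_pmf
  proof (rule nn_integral_pmf_mono)
    fix z assume z: "z \<in> set_pmf (pair_pmf p q)"
    then obtain x y where [simp]: "z = (x, y)" and xy: "x \<in> set_pmf p" "y \<in> set_pmf q"
      by (cases z) auto
    have "ln (pmf p x) + ln (pmf q y) = ln (pmf p x * pmf q y)"
      using xy by (intro ln_mult_pos[symmetric]) (simp_all add: pmf_positive)
    also have "\<dots> \<le> ln (pmf (map_pmf f (pair_pmf p q)) (f z))"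
      using pmf_map_ge[of "pair_pmf p q" z f] xy
      by (intro ln_mono) (simp_all add: pmf_pair pmf_positive)
    finally have "- ln (pmf (map_pmf f (pair_pmf p q)) (f z)) - (M + N)
        \<le> (- ln (pmf p x) - M) + (- ln (pmf q y) - N)" by simp
    then show "ennreal (- ln (pmf (map_pmf f (pair_pmf p q)) (f z)) - (M + N))
        \<le> ennreal (- ln (pmf p (fst z)) - M) + ennreal (- ln (pmf q (snd z)) - N)"
      by (simp add: order_trans[OF ennreal_leI ennreal_add_le])
  qed
  also have "\<dots> = entropy_excess p M + entropy_excess q N"
    by (simp add: nn_integral_pair_pmf' nn_integral_add entropy_excess_def
      measure_pmf.emeasure_space_1)
  finally show ?thesis .
qed

lemma entropy_excess_tendsto_0:
  assumes "shannon_entropy p < \<infinity>"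
  shows "(\<lambda>k. entropy_excess p (real k)) \<longlonglongrightarrow> 0"
proof -
  have "(\<lambda>k. \<integral>\<^sup>+x. ennreal (- ln (pmf p x) - real k) \<partial>p) \<longlonglongrightarrow> (\<integral>\<^sup>+x. 0 \<partial>p)"
  proof (rule nn_integral_dominated_convergence[where w = "\<lambda>x. ennreal (- ln (pmf p x) - 0)"])
    show "(\<integral>\<^sup>+x. ennreal (- ln (pmf p x) - 0) \<partial>p) < \<infinity>"
      using assms unfolding shannon_entropy_eq_entropy_excess entropy_excess_def .
    show "AE x in p. (\<lambda>k. ennreal (- ln (pmf p x) - real k)) \<longlonglongrightarrow> 0"
    proof (rule AE_I2)
      fix x
      have "\<forall>\<^sub>F k in sequentially. ennreal (- ln (pmf p x) - real k) = 0"
      proof (rule eventually_sequentiallyI)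
        fix k assume "nat \<lceil>- ln (pmf p x)\<rceil> \<le> k"
        then show "ennreal (- ln (pmf p x) - real k) = 0" by (intro ennreal_neg) linarith
      qed
      then show "(\<lambda>k. ennreal (- ln (pmf p x) - real k)) \<longlonglongrightarrow> 0" by (rule tendsto_eventually)
    qed
  qed (auto intro!: AE_I2 ennreal_leI)
  then show ?thesis by (simp add: entropy_excess_def)
qed

text \<open>For a positive weight \<open>w\<close>, the inequality \<open>ln (w / p) \<le> w / p -
  1\<close> gives \<open>- p ln p \<le> - p ln w + w\<close> at each point. Since it is pointwise it may
  be restricted to any set \<open>A\<close>, and \<open>w\<close> does not have to be normalised: its
  total mass is only an additive error.\<close>
lemma gibbs_inequality:
  assumes w: "\<And>x. x \<in> set_pmf p \<Longrightarrow> 0 < w x"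
  shows "(\<integral>\<^sup>+x. ennreal (- ln (pmf p x)) * indicator A x \<partial>p)
      \<le> (\<integral>\<^sup>+x. ennreal (- ln (w x)) * indicator A x \<partial>p) + (\<integral>\<^sup>+x. ennreal (w x) \<partial>count_space (set_pmf p))"
proof -
  have pt: "ennreal (pmf p x) * ennreal (- ln (pmf p x)) \<le> ennreal (pmf p x) * ennreal (- ln (w x)) + ennreal (w x)"
    if x: "x \<in> set_pmf p" for x
  proof -
    have p: "0 < pmf p x" using x by (rule pmf_positive)
    have "ln (w x / pmf p x) \<le> w x / pmf p x - 1"
      using p w[OF x] by (intro ln_le_minus_one) simp
    then have "- ln (pmf p x) \<le> - ln (w x) + w x / pmf p x"
      using p w[OF x] by (simp add: ln_div)
    then have "pmf p x * - ln (pmf p x) \<le> pmf p x * (- ln (w x) + w x / pmf p x)"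
      using p by (intro mult_left_mono) auto
    also have "\<dots> = pmf p x * - ln (w x) + w x" using p by (simp add: field_simps)
    finally have "ennreal (pmf p x * - ln (pmf p x)) \<le> ennreal (pmf p x * - ln (w x) + w x)"
      by (rule ennreal_leI)
    also have "\<dots> \<le> ennreal (pmf p x * - ln (w x)) + ennreal (w x)"
      by (rule ennreal_add_le)
    finally show ?thesis using p by (simp flip: ennreal_mult')
  qed
  show ?thesis
    unfolding nn_integral_pmf_eq_count_space
    by (subst nn_integral_add[symmetric], simp, simp, rule nn_integral_mono)
       (use pt in \<open>auto simp: indicator_def\<close>)
qed

text \<open>Comparing \<open>p\<close> with the summable weight \<open>exp (f - s d)\<close>, Gibbs'
  inequality leaves the mean of \<open>s d - f\<close>, which is dominated by a multiple of the
  exponential moment.\<close>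
lemma finite_shannon_entropy:
  fixes d f :: "'a \<Rightarrow> real"
  assumes Z: "(\<integral>\<^sup>+g. ennreal (exp (f g - s * d g)) \<partial>count_space (set_pmf p)) < \<infinity>"
    and t: "0 < t" and moment: "(\<lambda>g. exp (t * d g) * pmf p g) summable_on set_pmf p"
    and d: "\<And>g. 0 \<le> d g" and f: "\<And>g. \<bar>f g\<bar> \<le> K * exp (t * d g)"
  shows "shannon_entropy p < \<infinity>"
proof -
  let ?w = "\<lambda>g. exp (f g - s * d g)"
  define K' where "K' = \<bar>s\<bar> / t + K"
  have K: "0 \<le> K" 
    using order_trans[OF abs_ge_zero f] by (simp add: zero_le_mult_iff)
  have K': "0 \<le> K'" using K t by (simp add: K'_def)
  have lnw: "- ln (?w g) \<le> K' * exp (t * d g)" for g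
  proof -
    have "t * d g \<le> exp (t * d g)" using exp_ge_add_one_self[of "t * d g"] by linarith
    then have "(\<bar>s\<bar> / t) * (t * d g) \<le> (\<bar>s\<bar> / t) * exp (t * d g)"
      using t by (intro mult_left_mono) auto
    then have "\<bar>s\<bar> * d g \<le> (\<bar>s\<bar> / t) * exp (t * d g)" using t by simp
    moreover have "s * d g \<le> \<bar>s\<bar> * d g" using d by (intro mult_right_mono) auto
    ultimately show ?thesis using f[of g] by (simp add: K'_def distrib_right)
  qed
  have "entropy_excess p 0 = (\<integral>\<^sup>+g. ennreal (- ln (pmf p g)) * indicator UNIV g \<partial>p)"
    by (simp add: entropy_excess_def)
  also have "\<dots> \<le> (\<integral>\<^sup>+g. ennreal (- ln (?w g)) * indicator UNIV g \<partial>p)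
      + (\<integral>\<^sup>+g. ennreal (?w g) \<partial>count_space (set_pmf p))"
    by (rule gibbs_inequality) simp
  also have "(\<integral>\<^sup>+g. ennreal (- ln (?w g)) * indicator UNIV g \<partial>p) \<le> (\<integral>\<^sup>+g. ennreal (K' * exp (t * d g)) \<partial>p)"
    using lnw by (intro nn_integral_mono) (simp add: ennreal_leI)
  also have "\<dots> = (\<integral>\<^sup>+g. ennreal K' * ennreal (exp (t * d g) * pmf p g) \<partial>count_space (set_pmf p))"
    unfolding nn_integral_pmf_eq_count_space
    using K' by (intro nn_integral_cong) (simp add: mult_ac flip: ennreal_mult)
  also have "\<dots> = ennreal K' * ennreal (\<Sum>\<^sub>\<infinity>g\<in>set_pmf p. exp (t * d g) * pmf p g)"
    by (simp add: nn_integral_cmult infsum_ennreal_of_summable[OF moment]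
      flip: infsum_ennreal_eq_nn_integral)
  finally have "entropy_excess p 0
      \<le> ennreal K' * ennreal (\<Sum>\<^sub>\<infinity>g\<in>set_pmf p. exp (t * d g) * pmf p g)
        + (\<integral>\<^sup>+g. ennreal (?w g) \<partial>count_space (set_pmf p))"
    by (simp add: add_right_mono)
  also have "\<dots> < \<infinity>" using Z by (simp add: ennreal_mult_less_top)
  finally show ?thesis by (simp add: shannon_entropy_eq_entropy_excess)
qed

section \<open>Convolution powers and the entropy of a walk\<close>

lemma map_pair_pmf_conv_bind:
  "map_pmf (\<lambda>(x, y). f x y) (pair_pmf p q) = bind_pmf p (\<lambda>x. map_pmf (f x) q)"
  by (simp add: pair_pmf_def map_bind_pmf map_pmf_def bind_assoc_pmf bind_return_pmf)

lemma conv_power_add: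
  "conv_power \<mu> (m + n) = map_pmf (\<lambda>(g, h). g \<circ> h) (pair_pmf (conv_power \<mu> m) (conv_power \<mu> n))"
proof (induction n)
  case 0
  show ?case by (simp add: map_pair_pmf_conv_bind bind_return_pmf')
next
  case (Suc n)
  show ?case
    by (simp add: Suc map_pair_pmf_conv_bind bind_assoc_pmf map_bind_pmf bind_map_pmf map_pmf_comp comp_def)
qed

text \<open>\<open>conv_power\<close> appends an increment on the right; splitting off the first
  coordinate of a sequence of increments needs the recursion on the left.\<close>
lemma conv_power_Suc_left:
  "conv_power \<mu> (Suc n) = map_pmf (\<lambda>(g, h). g \<circ> h) (pair_pmf \<mu> (conv_power \<mu> n))"
proof -
  have "conv_power \<mu> 1 = \<mu>" by (simp add: map_pair_pmf_conv_bind bind_return_pmf comp_def)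
  then show ?thesis using conv_power_add[of \<mu> 1 n] by simp
qed

lemma set_conv_power_subset:
  assumes "id \<in> G" "\<And>g h. g \<in> G \<Longrightarrow> h \<in> G \<Longrightarrow> g \<circ> h \<in> G" "set_pmf \<mu> \<subseteq> G"
  shows "set_pmf (conv_power \<mu> n) \<subseteq> G"
proof (induction n)
  case 0
  show ?case using assms(1) by simp
next
  case (Suc n)
  show ?case
  proof
    fix k assume "k \<in> set_pmf (conv_power \<mu> (Suc n))"
    then obtain g h where "k = g \<circ> h" "g \<in> set_pmf (conv_power \<mu> n)" "h \<in> set_pmf \<mu>"
      by auto
    then show "k \<in> G" using Suc assms(2,3) by blast
  qed
qed

text \<open>The information of \<open>\<omega>\<^sub>n\<close> is at most the sum of those of the
  \<open>n\<close> increments. At level \<open>0\<close> this bounds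
  \<open>H(\<mu>\<^sup>*\<^sup>n)\<close> by \<open>n H(\<mu>)\<close>; at a high level it is the uniform
  integrability of the normalised information, with a bound linear in \<open>n\<close> and a slope that
  depends on \<open>\<mu>\<close> only.\<close>
lemma entropy_excess_conv_power: "entropy_excess (conv_power \<mu> n) (real n * M) \<le> of_nat n * entropy_excess \<mu> M"
proof (induction n)
  case 0
  show ?case by (simp add: entropy_excess_def)
next
  case (Suc n)
  have "entropy_excess (conv_power \<mu> (Suc n)) (real n * M + M)
      \<le> entropy_excess (conv_power \<mu> n) (real n * M) + entropy_excess \<mu> M"
    unfolding conv_power.simps by (rule entropy_excess_map_pair)
  also have "\<dots> \<le> of_nat n * entropy_excess \<mu> M + entropy_excess \<mu> M"
    by (rule add_right_mono) (rule Suc)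
  finally show ?case by (simp add: algebra_simps)
qed

lemma shannon_entropy_conv_power_add:
  "shannon_entropy (conv_power \<mu> (m + n))
     \<le> shannon_entropy (conv_power \<mu> m) + shannon_entropy (conv_power \<mu> n)"
  unfolding shannon_entropy_eq_entropy_excess conv_power_add
  using entropy_excess_map_pair[of _ _ _ 0 0] by simp

lemma shannon_entropy_conv_power_finite:
  assumes "shannon_entropy \<mu> < \<infinity>"
  shows "shannon_entropy (conv_power \<mu> n) < \<infinity>"
proof -
  have "shannon_entropy (conv_power \<mu> n) \<le> of_nat n * shannon_entropy \<mu>"
    using entropy_excess_conv_power[of \<mu> n 0] by (simp add: shannon_entropy_eq_entropy_excess)
  also have "\<dots> < \<infinity>"
    using assms by (simp add: ennreal_mult_less_top of_nat_less_top)
  finally show ?thesis .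
qed

text \<open>Fekete's argument: division with remainder by \<open>m\<close> bounds \<open>a n / n\<close>
  by \<open>a m / m + O(1 / n)\<close>, so the sequence converges to its infimum.\<close>
lemma subadditive_convergent:
  fixes a :: "nat \<Rightarrow> real"
  assumes nonneg: "\<And>n. 0 \<le> a n" and sub: "\<And>m n. a (m + n) \<le> a m + a n"
  shows "convergent (\<lambda>n. a n / real n)"
proof -
  define L where "L = (INF n\<in>{1..}. a n / real n)"
  have bdd: "bdd_below ((\<lambda>n. a n / real n) ` {1..})"
    by (rule bdd_belowI[of _ 0]) (auto simp: nonneg)
  have mult: "a (q * m + r) \<le> real q * a m + a r" for q m r
  proof (induction q)
    case (Suc q)
    have "a (Suc q * m + r) \<le> a m + a (q * m + r)"
      using sub[of m "q * m + r"] by (simp add: add.assoc)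
    also have "\<dots> \<le> a m + (real q * a m + a r)" using Suc by simp
    finally show ?case by (simp add: algebra_simps)
  qed simp
  have "(\<lambda>n. a n / real n) \<longlonglongrightarrow> L"
  proof (rule LIMSEQ_I)
    fix e :: real assume e: "0 < e"
    have "L < L + e / 2" using e by simp
    then obtain m where m: "1 \<le> m" "a m / real m < L + e / 2"
      unfolding L_def using cINF_less_iff[OF _ bdd, of "L + e / 2"] by (auto simp: L_def)
    define R where "R = (\<Sum>r<m. a r)"
    have "(\<lambda>n. R / real n) \<longlonglongrightarrow> 0" by real_asymp
    then obtain N where N: "\<And>n. n \<ge> N \<Longrightarrow> \<bar>R / real n\<bar> < e / 2"
      using LIMSEQ_D[of _ 0 "e / 2"] e by fastforce
    show "\<exists>no. \<forall>n\<ge>no. norm (a n / real n - L) < e"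
    proof (intro exI allI impI)
      fix n assume n: "max 1 N \<le> n"
      have "a n \<le> real (n div m) * a m + a (n mod m)"
        using mult[of "n div m" m "n mod m"] by simp
      also have "a (n mod m) \<le> R"
        unfolding R_def using m by (intro member_le_sum) (auto simp: nonneg)
      also have "real (n div m) * a m \<le> (real n / real m) * a m"
        by (intro mult_right_mono nonneg) (rule of_nat_div_le_of_nat)
      finally have "a n / real n \<le> (real n / real m * a m + R) / real n"
        using n by (intro divide_right_mono) auto
      also have "\<dots> = a m / real m + R / real n" using n m by (simp add: field_simps)
      also have "\<dots> < L + e" using m(2) N[of n] n abs_ge_self[of "R / real n"] by linarith
      finally have 1: "a n / real n < L + e" .
      have "L \<le> a n / real n" unfolding L_def using n by (intro cINF_lower bdd) auto
      then show "norm (a n / real n - L) < e" using 1 e by simp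
    qed
  qed
  then show ?thesis by (rule convergentI)
qed

text \<open>Turns the limit in the definition of the entropy of the walk, which is taken in the extended
  reals, into a limit of real numbers.\<close>
lemma walk_entropy_is_limit:
  assumes "shannon_entropy \<mu> < \<infinity>"
  shows "\<exists>h\<ge>0. (\<lambda>n. enn2real (shannon_entropy (conv_power \<mu> n)) / real n) \<longlonglongrightarrow> h
    \<and> walk_entropy \<mu> = ereal h"
proof -
  let ?H = "\<lambda>n. shannon_entropy (conv_power \<mu> n)"
  have fin: "?H n < \<infinity>" for n using assms by (rule shannon_entropy_conv_power_finite)
  have "convergent (\<lambda>n. enn2real (?H n) / real n)"
  proof (rule subadditive_convergent)
    fix m n
    have "enn2real (?H (m + n)) \<le> enn2real (?H m + ?H n)"
      using fin by (intro enn2real_mono shannon_entropy_conv_power_add) simp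
    also have "\<dots> = enn2real (?H m) + enn2real (?H n)"
      using fin by (intro enn2real_plus) auto
    finally show "enn2real (?H (m + n)) \<le> enn2real (?H m) + enn2real (?H n)" .
  qed simp
  then obtain h where h: "(\<lambda>n. enn2real (?H n) / real n) \<longlonglongrightarrow> h"
    by (auto simp: convergent_def)
  have "0 \<le> h" by (rule LIMSEQ_le_const[OF h]) auto
  have "(\<lambda>n. ereal (enn2real (?H n) / real n)) \<longlonglongrightarrow> ereal h" using h by simp
  moreover have "\<forall>\<^sub>F n in sequentially.
      ereal (enn2real (?H n) / real n) = enn2ereal (?H n) / ereal (real n)"
    using eventually_gt_at_top[of 0]
  proof eventually_elim
    case (elim n)
    have "?H n = ennreal (enn2real (?H n))" using fin[of n] by simp
    then have "enn2ereal (?H n) = ereal (enn2real (?H n))" by (metis enn2ereal_ennreal enn2real_nonneg)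
    then show ?case using elim by simp
  qed
  ultimately have "(\<lambda>n. enn2ereal (?H n) / ereal (real n)) \<longlonglongrightarrow> ereal h"
    by (rule Lim_transform_eventually)
  then have "walk_entropy \<mu> = ereal h" unfolding walk_entropy_def by (rule limI)
  with h \<open>0 \<le> h\<close> show ?thesis by blast
qed

section \<open>The law of the position of a walk\<close>

lemma walk_case_nat: "walk (case_nat a \<omega>) (Suc n) = a \<circ> walk \<omega> n"
proof (induction n)
  case (Suc n)
  have "walk (case_nat a \<omega>) (Suc (Suc n)) = walk (case_nat a \<omega>) (Suc n) \<circ> \<omega> n"
    by simp
  then show ?case using Suc by (simp add: o_assoc del: walk.simps(2)) (simp add: o_assoc)
qed simp

text \<open>The self-maps of \<open>X\<close> may be so many that their composition is not measurable for
  the product of two discrete \<open>\<sigma>\<close>-algebras. So the increments are first sent into a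
  countable set by a map \<open>r\<close>.\<close>
lemma measurable_walk:
  fixes r :: "('x \<Rightarrow> 'x) \<Rightarrow> ('x \<Rightarrow> 'x)"
  assumes G: "countable G" "id \<in> G" "\<And>g h. g \<in> G \<Longrightarrow> h \<in> G \<Longrightarrow> g \<circ> h \<in> G"
    and r: "\<And>g. r g \<in> G"
  shows "(\<lambda>g. walk (\<lambda>i. r (g i)) n) \<in> iid_increments \<mu> \<rightarrow>\<^sub>M count_space G"
proof (induction n)
  case 0
  show ?case using G(2) by (simp add: id_def)
next
  case (Suc n)
  have coord: "(\<lambda>g. r (g n)) \<in> iid_increments \<mu> \<rightarrow>\<^sub>M count_space G"
    unfolding iid_increments_def
    by (rule measurable_compose[OF measurable_component_singleton[of n]]) (use r in auto)
  have "(\<lambda>g. walk (\<lambda>i. r (g i)) n \<circ> r (g n)) \<in> iid_increments \<mu> \<rightarrow>\<^sub>M count_space G"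
  proof (rule measurable_compose_countable'[OF _ Suc G(1)])
    fix h assume "h \<in> G"
    then show "(\<lambda>g. h \<circ> r (g n)) \<in> iid_increments \<mu> \<rightarrow>\<^sub>M count_space G"
      using G(3)[of h] by (intro measurable_compose[OF coord]) (simp add: Pi_iff del: o_apply)
  qed
  then show ?case by (simp only: walk.simps(2))
qed

text \<open>Induction on \<open>n\<close>, splitting off the first increment: a sequence of independent
  increments is a pair of its head and an independent sequence with the same law.\<close>
lemma nn_integral_walk:
  fixes r :: "('x \<Rightarrow> 'x) \<Rightarrow> ('x \<Rightarrow> 'x)"
  assumes G: "countable G" "id \<in> G" "\<And>g h. g \<in> G \<Longrightarrow> h \<in> G \<Longrightarrow> g \<circ> h \<in> G"
    and r: "\<And>g. r g \<in> G" "\<And>g. g \<in> set_pmf \<mu> \<Longrightarrow> r g = g"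
  shows "(\<integral>\<^sup>+g. f (walk (\<lambda>i. r (g i)) n) \<partial>iid_increments \<mu>) = (\<integral>\<^sup>+h. f h \<partial>conv_power \<mu> n)"
proof (induction n arbitrary: f)
  case 0
  interpret prob_space "iid_increments \<mu>"
    unfolding iid_increments_def by (intro prob_space_PiM measure_pmf.prob_space_axioms)
  show ?case by (simp add: emeasure_space_1 flip: id_def)
next
  case (Suc n)
  interpret sequence_space "measure_pmf \<mu>"
    unfolding sequence_space_def by (intro product_prob_spaceI measure_pmf.prob_space_axioms)
  have S: "S = iid_increments \<mu>" by (simp add: iid_increments_def)
  have meas: "(\<lambda>g. f (walk (\<lambda>i. r (g i)) m)) \<in> borel_measurable S" for f :: "('x \<Rightarrow> 'x) \<Rightarrow> ennreal" and m
    unfolding S by (rule measurable_compose[OF measurable_walk[OF G r(1)]]) simp_all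
  have cons: "(\<lambda>(a, \<omega>). case_nat a \<omega>) \<in> measure_pmf \<mu> \<Otimes>\<^sub>M S \<rightarrow>\<^sub>M S"
    by measurable
  have walk: "walk (\<lambda>i. r (case_nat a \<omega> i)) (Suc n) = r a \<circ> walk (\<lambda>i. r (\<omega> i)) n" for a \<omega>
  proof -
    have "(\<lambda>i. r (case_nat a \<omega> i)) = case_nat (r a) (\<lambda>i. r (\<omega> i))"
      by (auto split: nat.split)
    then show ?thesis by (simp only: walk_case_nat)
  qed
  have "(\<integral>\<^sup>+g. f (walk (\<lambda>i. r (g i)) (Suc n)) \<partial>S)
      = (\<integral>\<^sup>+z. f (walk (\<lambda>i. r ((case z of (a, \<omega>) \<Rightarrow> case_nat a \<omega>) i)) (Suc n)) \<partial>(measure_pmf \<mu> \<Otimes>\<^sub>M S))"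
    by (subst PiM_iter[symmetric]) (rule nn_integral_distr[OF cons], simp only: measurable_distr_eq1 meas)
  also have "\<dots> = (\<integral>\<^sup>+a. \<integral>\<^sup>+\<omega>. f (walk (\<lambda>i. r (case_nat a \<omega> i)) (Suc n)) \<partial>S \<partial>\<mu>)"
    by (subst nn_integral_fst[symmetric, OF measurable_compose[OF cons meas]]) simp
  also have "\<dots> = (\<integral>\<^sup>+a. \<integral>\<^sup>+h. f (r a \<circ> h) \<partial>conv_power \<mu> n \<partial>\<mu>)"
    unfolding walk S
  proof (rule nn_integral_cong)
    fix a
    show "(\<integral>\<^sup>+\<omega>. f (r a \<circ> walk (\<lambda>i. r (\<omega> i)) n) \<partial>iid_increments \<mu>)
        = (\<integral>\<^sup>+h. f (r a \<circ> h) \<partial>conv_power \<mu> n)"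
      by (rule Suc)
  qed
  also have "\<dots> = (\<integral>\<^sup>+a. \<integral>\<^sup>+h. f (a \<circ> h) \<partial>conv_power \<mu> n \<partial>\<mu>)"
    by (rule nn_integral_pmf_cong) (simp add: r(2))
  also have "\<dots> = (\<integral>\<^sup>+h. f h \<partial>conv_power \<mu> (Suc n))"
    unfolding conv_power_Suc_left by (simp add: nn_integral_pair_pmf')
  finally show ?case unfolding S .
qed

text \<open>Almost sure statements on trajectories become statements in probability on the laws of the
  positions, by dominated convergence of indicator functions.\<close>
lemma AE_walk_imp_conv_power_tendsto:
  assumes G: "countable G" "id \<in> G" "\<And>g h. g \<in> G \<Longrightarrow> h \<in> G \<Longrightarrow> g \<circ> h \<in> G"
    and \<mu>: "set_pmf \<mu> \<subseteq> G"
    and ae: "AE g in iid_increments \<mu>. \<forall>\<^sub>F n in sequentially. walk g n \<in> Q n"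
  shows "(\<lambda>n. emeasure (conv_power \<mu> n) (- Q n)) \<longlonglongrightarrow> 0"
proof -
  \<comment> \<open>Almost surely all increments lie in the support, and then \<open>r\<close> changes nothing.\<close>
  define r where "r g = (if g \<in> set_pmf \<mu> then g else id)" for g
  have r: "r g \<in> G" "g \<in> set_pmf \<mu> \<Longrightarrow> r g = g" for g
    using \<mu> G(2) by (auto simp: r_def)
  let ?W = "\<lambda>n g. walk (\<lambda>i. r (g i)) n"
  interpret prob_space "iid_increments \<mu>"
    unfolding iid_increments_def by (intro prob_space_PiM measure_pmf.prob_space_axioms)
  have "AE g in iid_increments \<mu>. g i \<in> set_pmf \<mu>" for i
    unfolding iid_increments_def
    by (rule AE_PiM_component[where M = "\<lambda>_. measure_pmf \<mu>"])
       (auto intro: measure_pmf.prob_space_axioms AE_pmfI)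
  then have "AE g in iid_increments \<mu>. \<forall>i. g i \<in> set_pmf \<mu>" by (simp add: AE_all_countable)
  then have ev: "AE g in iid_increments \<mu>. \<forall>\<^sub>F n in sequentially. ?W n g \<in> Q n"
    using ae
  proof eventually_elim
    case (elim g)
    then have "(\<lambda>i. r (g i)) = g" by (simp add: r_def)
    then show ?case using elim by simp
  qed
  have "(\<lambda>n. \<integral>\<^sup>+g. indicator (- Q n) (?W n g) \<partial>iid_increments \<mu>)
      \<longlonglongrightarrow> (\<integral>\<^sup>+g. 0 \<partial>iid_increments \<mu>)"
  proof (rule nn_integral_dominated_convergence[where w = "\<lambda>_. 1"])
    show "(\<lambda>g. indicator (- Q n) (?W n g)) \<in> borel_measurable (iid_increments \<mu>)" for n
      by (rule measurable_compose[OF measurable_walk[OF G r(1)]]) simp_all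
    show "AE g in iid_increments \<mu>. (\<lambda>n. indicator (- Q n) (?W n g) :: ennreal) \<longlonglongrightarrow> 0"
      using ev
    proof eventually_elim
      case (elim g)
      then have "\<forall>\<^sub>F n in sequentially. (indicator (- Q n) (?W n g) :: ennreal) = 0"
        by eventually_elim simp
      then show ?case by (rule tendsto_eventually)
    qed
  qed (auto simp: emeasure_space_1 indicator_def)
  moreover have "(\<integral>\<^sup>+g. indicator (- Q n) (?W n g) \<partial>iid_increments \<mu>)
      = emeasure (conv_power \<mu> n) (- Q n)" for n
    by (subst nn_integral_walk[OF G r]) simp_all
  ultimately show ?thesis by simp
qed

section \<open>Entropy against drift\<close>

text \<open>The core of the argument, for arbitrary functions \<open>d\<close> and \<open>f\<close> with
  linear growth along the walk. With high probability \<open>\<omega>\<^sub>n\<close> lies in the set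
  \<open>Q n\<close> where \<open>d / n\<close> is close to \<open>l\<close> and \<open>f / n\<close> is
  almost at least \<open>lf\<close>. There Gibbs' inequality for the weight \<open>exp (f - s d)\<close>
  bounds the entropy by about \<open>n (s l - lf)\<close>. Outside \<open>Q n\<close>, the information up
  to \<open>n k\<close> contributes at most \<open>n k\<close> times a small probability, and the
  information above \<open>n k\<close> at most \<open>n\<close> times the excess of \<open>\<mu>\<close>
  at level \<open>k\<close>.\<close>
lemma entropy_rate_le:
  fixes \<mu> :: "('x \<Rightarrow> 'x) pmf" and d f :: "('x \<Rightarrow> 'x) \<Rightarrow> real"
  assumes G: "countable G" "id \<in> G" "\<And>g h. g \<in> G \<Longrightarrow> h \<in> G \<Longrightarrow> g \<circ> h \<in> G"
    and \<mu>: "set_pmf \<mu> \<subseteq> G" and fin: "shannon_entropy \<mu> < \<infinity>"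
    and Z: "(\<integral>\<^sup>+g. ennreal (exp (f g - s * d g)) \<partial>count_space G) < \<infinity>"
    and l: "AE g in iid_increments \<mu>. (\<lambda>n. 1 / real n * d (walk g n)) \<longlonglongrightarrow> l"
    and lf: "AE g in iid_increments \<mu>. (\<lambda>n. 1 / real n * f (walk g n)) \<longlonglongrightarrow> lf"
    and h: "(\<lambda>n. enn2real (shannon_entropy (conv_power \<mu> n)) / real n) \<longlonglongrightarrow> h"
  shows "h \<le> s * l - lf"
proof (rule field_le_epsilon)
  fix \<epsilon> :: real assume "0 < \<epsilon>"
  \<comment> \<open>Errors of \<open>e\<close> in both drifts change \<open>s l - lf\<close> by at most \<open>|s| e + e = \<epsilon>\<close>.\<close>
  define e where "e = \<epsilon> / (\<bar>s\<bar> + 1)"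
  have e: "0 < e" using \<open>0 < \<epsilon>\<close> by (simp add: e_def)
  have e_eq: "\<bar>s\<bar> * e + e = \<epsilon>"
  proof -
    have "\<bar>s\<bar> * e + e = (\<bar>s\<bar> + 1) * e" by (simp add: distrib_right)
    also have "\<dots> = \<epsilon>" by (simp add: e_def)
    finally show ?thesis .
  qed
  define c where "c = s * l - lf + \<epsilon>"
  let ?w = "\<lambda>g. exp (f g - s * d g)"
  let ?p = "conv_power \<mu>"
  define Q where "Q n = {g. \<bar>1 / real n * d g - l\<bar> < e \<and> lf - e < 1 / real n * f g}" for n
  define b where "b n = measure (?p n) (- Q n)" for n
  have supp: "set_pmf (?p n) \<subseteq> G" for n by (rule set_conv_power_subset[OF G(2,3) \<mu>])
  have "AE g in iid_increments \<mu>. \<forall>\<^sub>F n in sequentially. walk g n \<in> Q n"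
    using l lf
  proof eventually_elim
    case (elim g)
    have "\<forall>\<^sub>F n in sequentially. dist (1 / real n * d (walk g n)) l < e"
      using tendstoD[OF elim(1) e] .
    moreover have "\<forall>\<^sub>F n in sequentially. lf - e < 1 / real n * f (walk g n)"
      using order_tendstoD(1)[OF elim(2), of "lf - e"] e by simp
    ultimately show ?case by eventually_elim (simp add: Q_def dist_real_def)
  qed
  from AE_walk_imp_conv_power_tendsto[OF G \<mu> this]
  have "(\<lambda>n. emeasure (?p n) (- Q n)) \<longlonglongrightarrow> 0" .
  then have b: "b \<longlonglongrightarrow> 0"
    unfolding b_def[abs_def] measure_pmf.emeasure_eq_measure by (simp add: ennreal_tendsto_0_iff)
  have lnw: "- ln (?w g) \<le> real n * c" if "g \<in> Q n" "0 < n" for g n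
  proof -
    have "s * (1 / real n * d g - l) \<le> \<bar>s * (1 / real n * d g - l)\<bar>" by (rule abs_ge_self)
    also have "\<dots> \<le> \<bar>s\<bar> * e"
      unfolding abs_mult using that(1) by (intro mult_left_mono) (auto simp: Q_def)
    finally have "s * (1 / real n * d g) - 1 / real n * f g \<le> c"
      using that(1) e_eq by (simp add: Q_def c_def right_diff_distrib)
    then have "real n * (s * (1 / real n * d g) - 1 / real n * f g) \<le> real n * c"
      by (rule mult_left_mono) simp
    then show ?thesis using that(2) by (simp add: right_diff_distrib)
  qed
  define z where "z = enn2real (\<integral>\<^sup>+g. ennreal (?w g) \<partial>count_space G)"
  have z: "(\<integral>\<^sup>+g. ennreal (?w g) \<partial>count_space G) = ennreal z" "0 \<le> z"
    using Z by (simp_all add: z_def)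
  have w_le: "?w g \<le> z" if "g \<in> G" for g
  proof -
    have "ennreal (?w g) = (\<integral>\<^sup>+x. ennreal (?w g) * indicator {g} x \<partial>count_space G)"
      using that by (subst nn_integral_cmult_indicator) auto
    also have "\<dots> \<le> (\<integral>\<^sup>+g. ennreal (?w g) \<partial>count_space G)"
      by (rule nn_integral_mono) (simp split: split_indicator)
    finally show ?thesis using z by simp
  qed
  \<comment> \<open>Integrals of truncated functions bound the entropy by the positive part of \<open>n c\<close> only. But \<open>c\<close>
    cannot be negative: a point of \<open>Q n\<close> would have weight at least \<open>exp (- n c)\<close>, and weights
    are bounded by \<open>z\<close>.\<close>
  have "0 \<le> c"
  proof -
    have "\<forall>\<^sub>F n in sequentially. 0 \<le> c + ln z / real n"
      using order_tendstoD(2)[OF b, of 1, OF zero_less_one] eventually_gt_at_top[of 0]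
    proof eventually_elim
      case (elim n)
      have "\<exists>g\<in>set_pmf (?p n). g \<in> Q n"
      proof (rule ccontr)
        assume "\<not> ?thesis"
        then have "b n = 1"
          unfolding b_def by (intro measure_pmf.prob_eq_1[THEN iffD2]) (auto simp: AE_measure_pmf_iff)
        with elim(1) show False by simp
      qed
      then obtain g where "g \<in> G" "g \<in> Q n" using supp by blast
      then have "- ln z \<le> - ln (?w g)"
        using w_le by (simp only: neg_le_iff_le) (intro ln_mono, auto)
      also have "\<dots> \<le> real n * c" using lnw \<open>g \<in> Q n\<close> elim(2) .
      finally show ?case using elim(2) by (simp add: field_simps)
    qed
    moreover have "(\<lambda>n. c + ln z / real n) \<longlonglongrightarrow> c" by real_asymp
    ultimately show ?thesis by (intro tendsto_lowerbound) auto
  qed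
  have main: "shannon_entropy (?p n)
      \<le> ennreal (real n * c) + ennreal z + (ennreal (real n * real k * b n) + of_nat n * entropy_excess \<mu> (real k))"
    if n: "0 < n" for n k :: nat
  proof -
    let ?I = "\<lambda>g. ennreal (- ln (pmf (?p n) g))"
    have "shannon_entropy (?p n) = (\<integral>\<^sup>+g. ?I g * indicator (Q n) g + ?I g * indicator (- Q n) g \<partial>?p n)"
      unfolding shannon_entropy_eq_entropy_excess entropy_excess_def
      by (intro nn_integral_cong) (simp split: split_indicator)
    also have "\<dots> = (\<integral>\<^sup>+g. ?I g * indicator (Q n) g \<partial>?p n) + (\<integral>\<^sup>+g. ?I g * indicator (- Q n) g \<partial>?p n)"
      by (rule nn_integral_add) simp_all
    also have "\<dots> \<le> (ennreal (real n * c) + ennreal z)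
        + (ennreal (real n * real k * b n) + of_nat n * entropy_excess \<mu> (real k))"
    proof (rule add_mono)
      have "(\<integral>\<^sup>+g. ?I g * indicator (Q n) g \<partial>?p n)
          \<le> (\<integral>\<^sup>+g. ennreal (- ln (?w g)) * indicator (Q n) g \<partial>?p n) + (\<integral>\<^sup>+g. ennreal (?w g) \<partial>count_space (set_pmf (?p n)))"
        by (rule gibbs_inequality) simp
      also have "\<dots> \<le> ennreal (real n * c) + ennreal z"
      proof (rule add_mono)
        have "(\<integral>\<^sup>+g. ennreal (- ln (?w g)) * indicator (Q n) g \<partial>?p n) \<le> (\<integral>\<^sup>+g. ennreal (real n * c) \<partial>?p n)"
          using lnw[OF _ n] by (intro nn_integral_mono) (auto split: split_indicator intro: ennreal_leI)
        then show "(\<integral>\<^sup>+g. ennreal (- ln (?w g)) * indicator (Q n) g \<partial>?p n) \<le> ennreal (real n * c)"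
          by (simp add: measure_pmf.emeasure_space_1)
        show "(\<integral>\<^sup>+g. ennreal (?w g) \<partial>count_space (set_pmf (?p n))) \<le> ennreal z"
          unfolding z(1)[symmetric] by (rule nn_integral_count_space_mono_set[OF supp])
      qed
      finally show "(\<integral>\<^sup>+g. ?I g * indicator (Q n) g \<partial>?p n) \<le> ennreal (real n * c) + ennreal z" .
      have "(\<integral>\<^sup>+g. ?I g * indicator (- Q n) g \<partial>?p n)
          \<le> (\<integral>\<^sup>+g. ennreal (real n * real k) * indicator (- Q n) g + ennreal (- ln (pmf (?p n) g) - real n * real k) \<partial>?p n)"
      proof (rule nn_integral_mono)
        fix g
        have "?I g \<le> ennreal (real n * real k) + ennreal (- ln (pmf (?p n) g) - real n * real k)"
          using ennreal_add_le[of "real n * real k" "- ln (pmf (?p n) g) - real n * real k"] by simp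
        then show "?I g * indicator (- Q n) g
            \<le> ennreal (real n * real k) * indicator (- Q n) g + ennreal (- ln (pmf (?p n) g) - real n * real k)"
          by (simp split: split_indicator)
      qed
      also have "\<dots> = ennreal (real n * real k) * emeasure (?p n) (- Q n) + entropy_excess (?p n) (real n * real k)"
        by (simp add: nn_integral_add nn_integral_cmult_indicator entropy_excess_def)
      also have "ennreal (real n * real k) * emeasure (?p n) (- Q n) = ennreal (real n * real k * b n)"
        by (simp add: b_def measure_pmf.emeasure_eq_measure ennreal_mult)
      also have "entropy_excess (?p n) (real n * real k) \<le> of_nat n * entropy_excess \<mu> (real k)"
        by (rule entropy_excess_conv_power)
      finally show "(\<integral>\<^sup>+g. ?I g * indicator (- Q n) g \<partial>?p n)
          \<le> ennreal (real n * real k * b n) + of_nat n * entropy_excess \<mu> (real k)"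
        by (simp add: add_left_mono)
    qed
    finally show ?thesis .
  qed
  have ex_fin: "entropy_excess \<mu> (real k) < \<infinity>" for k
  proof -
    have "entropy_excess \<mu> (real k) \<le> entropy_excess \<mu> 0"
      unfolding entropy_excess_def by (intro nn_integral_mono ennreal_leI) simp
    then show ?thesis using fin unfolding shannon_entropy_eq_entropy_excess by (rule le_less_trans)
  qed
  have hk: "h \<le> c + enn2real (entropy_excess \<mu> (real k))" for k
  proof (rule LIMSEQ_le[OF h])
    let ?x = "enn2real (entropy_excess \<mu> (real k))"
    have "(\<lambda>n. z / real n) \<longlonglongrightarrow> 0" by real_asymp
    then have "(\<lambda>n. c + z / real n + real k * b n + ?x) \<longlonglongrightarrow> c + 0 + real k * 0 + ?x"
      by (intro tendsto_intros b)
    then show "(\<lambda>n. c + z / real n + real k * b n + ?x) \<longlonglongrightarrow> c + ?x" by simp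
    have "enn2real (shannon_entropy (?p n)) / real n \<le> c + z / real n + real k * b n + ?x" if "1 \<le> n" for n
    proof -
      have "entropy_excess \<mu> (real k) = ennreal ?x" using ex_fin[of k] by simp
      then have "shannon_entropy (?p n) \<le> ennreal (real n * c + z + (real n * real k * b n + real n * ?x))"
        using main[of n k] that \<open>0 \<le> c\<close> z(2)
        by (simp add: b_def ennreal_mult ennreal_of_nat_eq_real_of_nat)
      then have "enn2real (shannon_entropy (?p n)) \<le> real n * c + z + (real n * real k * b n + real n * ?x)"
        using \<open>0 \<le> c\<close> z(2) by (intro enn2real_leI) (auto simp: b_def)
      then have "enn2real (shannon_entropy (?p n)) / real n
          \<le> (real n * c + z + (real n * real k * b n + real n * ?x)) / real n"
        by (rule divide_right_mono) simp
      also have "\<dots> = c + z / real n + real k * b n + ?x"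
        using that by (simp add: add_divide_distrib)
      finally show ?thesis .
    qed
    then show "\<exists>N. \<forall>n\<ge>N. enn2real (shannon_entropy (?p n)) / real n \<le> c + z / real n + real k * b n + ?x"
      by blast
  qed
  \<comment> \<open>With \<open>n\<close> gone, the truncation level \<open>k\<close> may tend to infinity.\<close>
  have "(\<lambda>k. enn2real (entropy_excess \<mu> (real k))) \<longlonglongrightarrow> 0"
    using entropy_excess_tendsto_0[OF fin] by (intro tendsto_enn2real) simp_all
  then have "(\<lambda>k. c + enn2real (entropy_excess \<mu> (real k))) \<longlonglongrightarrow> c + 0"
    by (rule tendsto_add[OF tendsto_const])
  then have "h \<le> c + 0" by (rule LIMSEQ_le_const) (use hk in auto)
  then show "h \<le> s * l - lf + \<epsilon>" by (simp add: c_def)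
qed

section \<open>Integrals of potentials along geodesics\<close>

lemma germ_in_unit_tangent: "c \<in> geodesic_lines \<Longrightarrow> germ c \<in> unit_tangent"
  unfolding germ_def unit_tangent_def by (rule quotientI)

lemma footpoint_germ:
  assumes "c \<in> geodesic_lines"
  shows "footpoint (germ c) = c 0"
proof -
  have "\<exists>\<epsilon>>0. \<forall>t\<in>{- \<epsilon>..\<epsilon>::real}. c t = c t"
    by (rule exI[of _ 1]) simp
  then have "c \<in> germ c"
    using assms unfolding germ_def germ_rel_def Image_singleton_iff mem_Collect_eq case_prod_conv
    by (intro conjI)
  moreover have "c' 0 = c 0" if "c' \<in> germ c" for c'
  proof -
    have "(c, c') \<in> germ_rel" using that by (simp only: germ_def Image_singleton_iff)
    then have "\<exists>\<epsilon>>0. \<forall>t\<in>{- \<epsilon>..\<epsilon>::real}. c t = c' t"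
      unfolding germ_rel_def by (simp only: mem_Collect_eq case_prod_conv)
    then obtain \<epsilon> :: real where "0 < \<epsilon>" and eq: "\<forall>t\<in>{- \<epsilon>..\<epsilon>}. c t = c' t"
      by (elim exE conjE)
    then show ?thesis using eq[rule_format, of 0] by (simp only: atLeastAtMost_iff) simp
  qed
  ultimately have "(\<lambda>c. c 0) ` germ c = {c 0}" by blast
  then show ?thesis by (simp add: footpoint_def)
qed

lemma geodesic_line_shift:
  assumes "c \<in> geodesic_lines"
  shows "(\<lambda>s. c (t + s)) \<in> geodesic_lines"
  using assms by (simp add: geodesic_lines_def)

lemma ex_geodesic_line_through:
  fixes x y :: "'x::metric_space"
  assumes "CAT_minus_one TYPE('x)" "geodesically_complete TYPE('x)" "x \<noteq> y"
  shows "\<exists>c. c \<in> geodesic_lines \<and> c 0 = x \<and> c (dist x y) = y"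
proof -
  obtain c where c: "geodesic_path c x y"
    using assms(1)[unfolded CAT_minus_one_def, THEN conjunct1]
    unfolding geodesic_space_def by auto
  then obtain c' where c': "c' \<in> geodesic_lines" "\<forall>t\<in>{0..dist x y}. c' t = c t"
    using assms(2)[unfolded geodesically_complete_def, rule_format, of x y c] assms(3) by auto
  have "c' 0 = c 0" "c' (dist x y) = c (dist x y)"
    using c'(2) by simp_all
  moreover have "c 0 = x" "c (dist x y) = y"
    using c unfolding geodesic_path_def by blast+
  ultimately show ?thesis
    using c'(1) by (intro exI[of _ c'] conjI) (simp_all only:)
qed

text \<open>Part (b) of the Hoelder control, with \<open>a = exp (t / 2)\<close>, bounds
  \<open>|F|\<close> along the geodesic from \<open>x\<close> to \<open>y\<close> by a multiple of
  \<open>exp (t d / 2)\<close>, where \<open>d\<close> is the distance of \<open>x\<close> and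
  \<open>y\<close>; the length of the geodesic is bounded by another such factor. The rate
  \<open>t\<close> is arbitrary, so an exponential moment of any exponent controls the mean of
  \<open>d\<^sub>F\<close>.\<close>
lemma dF_exp_bound:
  fixes F :: "(real \<Rightarrow> 'x::metric_space) set \<Rightarrow> real"
  assumes cat: "CAT_minus_one TYPE('x)" and gc: "geodesically_complete TYPE('x)"
    and H: "Holder_control F" and t: "0 < t"
  shows "\<exists>K\<ge>0. \<forall>y. \<bar>dF F x y\<bar> \<le> K * exp (t * dist x y)"
proof -
  define a where "a = exp (t / 2)"
  have "1 < a" using t by (simp add: a_def)
  then obtain b where b: "0 < b"
    "\<And>u w. u \<in> unit_tangent \<Longrightarrow> w \<in> unit_tangent \<Longrightarrow>
      \<bar>F u - F w\<bar> \<le> b * a powr dist (footpoint u) (footpoint w)"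
    using H unfolding Holder_control_def by blast
  define w where "w = (SOME u. u \<in> (unit_tangent :: (real \<Rightarrow> 'x) set set))"
  define C where "C = \<bar>F w\<bar> + b * exp (t / 2 * dist x (footpoint w))"
  have C: "0 \<le> C" using b(1) by (simp add: C_def)
  show ?thesis
  proof (intro exI[of _ "C * (2 / t)"] conjI allI)
    show "0 \<le> C * (2 / t)" using C t by simp
    fix y
    define d where "d = dist x y"
    define B where "B = C * exp (t / 2 * d)"
    have B: "0 \<le> B" using C by (simp add: B_def)
    show "\<bar>dF F x y\<bar> \<le> C * (2 / t) * exp (t * dist x y)"
    proof (cases "x = y")
      case True
      then show ?thesis using C t by (simp add: dF_def)
    next
      case False
      define c where "c = (SOME c. c \<in> geodesic_lines \<and> c 0 = x \<and> c (dist x y) = y)"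
      have c: "c \<in> geodesic_lines" "c 0 = x" "c (dist x y) = y"
        using someI_ex[OF ex_geodesic_line_through[OF cat gc False]] by (auto simp: c_def)
      have "w \<in> unit_tangent"
        unfolding w_def using germ_in_unit_tangent[OF c(1)] by (rule someI)
      have bound: "norm (F (germ (\<lambda>r. c (s + r)))) \<le> B" if s: "s \<in> {0..d}" for s
      proof -
        let ?u = "germ (\<lambda>r. c (s + r))"
        have shift: "(\<lambda>r. c (s + r)) \<in> geodesic_lines"
          using c(1) by (rule geodesic_line_shift)
        have u: "?u \<in> unit_tangent" "footpoint ?u = c s"
          using germ_in_unit_tangent[OF shift] footpoint_germ[OF shift] by simp_all
        have "dist (c 0) (c s) = \<bar>0 - s\<bar>"
          using c(1) by (simp only: geodesic_lines_def mem_Collect_eq)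
        then have "dist x (c s) \<le> d" using s by (simp add: c(2))
        then have "dist (c s) (footpoint w) \<le> d + dist x (footpoint w)"
          using dist_triangle3[of "c s" "footpoint w" x] by linarith
        then have pw: "a powr dist (c s) (footpoint w) \<le> exp (t / 2 * (d + dist x (footpoint w)))"
          using t by (simp add: a_def exp_powr_real)
        have "\<bar>F ?u\<bar> \<le> \<bar>F w\<bar> + b * a powr dist (c s) (footpoint w)"
          using b(2)[OF u(1) \<open>w \<in> unit_tangent\<close>] u(2) by simp
        also have "\<dots> \<le> \<bar>F w\<bar> + b * exp (t / 2 * (d + dist x (footpoint w)))"
          using b(1) pw by simp
        also have "\<dots> = \<bar>F w\<bar> * 1 + b * exp (t / 2 * dist x (footpoint w)) * exp (t / 2 * d)"
          by (simp add: algebra_simps exp_add)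
        also have "\<dots> \<le> \<bar>F w\<bar> * exp (t / 2 * d) + b * exp (t / 2 * dist x (footpoint w)) * exp (t / 2 * d)"
          using t by (intro add_right_mono mult_left_mono) (auto simp: d_def)
        also have "\<dots> = B" by (simp add: B_def C_def algebra_simps)
        finally show ?thesis by simp
      qed
      have "\<bar>dF F x y\<bar> \<le> B * d"
      \<comment> \<open>A non-integrable function has integral \<open>0\<close>.\<close>
      proof (cases "(\<lambda>s. F (germ (\<lambda>r. c (s + r)))) integrable_on {0..d}")
        case True
        have "norm (integral {0..d} (\<lambda>s. F (germ (\<lambda>r. c (s + r))))) \<le> B * d"
          using has_integral_bound_real[OF B finite.emptyI integrable_integral[OF True]] bound by (simp add: d_def)
        then show ?thesis by (simp add: dF_def c_def d_def)
      next
        case False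
        then have "dF F x y = 0"
          by (simp add: dF_def c_def d_def not_integrable_integral)
        then show ?thesis using B by (simp add: d_def)
      qed
      also have "d \<le> (2 / t) * exp (t / 2 * d)"
      proof -
        have "t / 2 * d \<le> exp (t / 2 * d)"
          using exp_ge_add_one_self[of "t / 2 * d"] by linarith
        then have "(2 / t) * (t / 2 * d) \<le> (2 / t) * exp (t / 2 * d)"
          using t by (intro mult_left_mono) auto
        then show ?thesis using t by simp
      qed
      also have "B * ((2 / t) * exp (t / 2 * d)) = C * (2 / t) * exp (t * d)"
      proof -
        have "exp (t / 2 * d) * exp (t / 2 * d) = exp (t * d)"
          unfolding exp_add[symmetric] by simp
        then show ?thesis by (simp add: B_def ac_simps)
      qed
      finally show ?thesis using B by (simp add: d_def mult_left_mono)
    qed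
  qed
qed

section \<open>Pressure and convergence of the Poincare series\<close>

lemma finite_orbit_ball:
  fixes x0 :: "'x::heine_borel"
  assumes "properly_discontinuous \<Gamma>"
  shows "finite {g \<in> \<Gamma>. dist x0 (g x0) \<le> r}"
proof (cases "0 \<le> r")
  case True
  have "finite {g \<in> \<Gamma>. g ` cball x0 r \<inter> cball x0 r \<noteq> {}}"
    using assms compact_cball unfolding properly_discontinuous_def by blast
  moreover have "{g \<in> \<Gamma>. dist x0 (g x0) \<le> r} \<subseteq> {g \<in> \<Gamma>. g ` cball x0 r \<inter> cball x0 r \<noteq> {}}"
  proof (intro subsetI CollectI, elim CollectE conjE, intro conjI)
    fix g assume "dist x0 (g x0) \<le> r"
    then have "g x0 \<in> g ` cball x0 r \<inter> cball x0 r" using True by simp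
    then show "g ` cball x0 r \<inter> cball x0 r \<noteq> {}" by blast
  qed
  ultimately show ?thesis by (rule finite_subset[rotated])
next
  case False
  then have "{g \<in> \<Gamma>. dist x0 (g x0) \<le> r} = {}" 
    using order_trans[OF zero_le_dist] by fastforce
  then show ?thesis by (simp only: finite.emptyI)
qed

text \<open>Above the pressure the Poincare series of the potential converges: on the annulus of radius
  \<open>n\<close> the weight differs from \<open>exp (d\<^sub>F - s n)\<close> by a bounded factor, and
  for \<open>s'\<close> between the pressure and \<open>s\<close> the annuli contribute at most a
  geometric series of ratio \<open>exp (s' - s)\<close>. Annuli share their boundary spheres, which is
  harmless for an upper bound.\<close>
lemma finite_partition_function:
  fixes x0 :: "'x::heine_borel"
  assumes pd: "properly_discontinuous \<Gamma>" and s: "pressure \<Gamma> F x0 < ereal s"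
  shows "(\<integral>\<^sup>+g. ennreal (exp (dF F x0 (g x0) - s * dist x0 (g x0))) \<partial>count_space \<Gamma>) < \<infinity>"
proof -
  let ?d = "\<lambda>g. dist x0 (g x0)"
  let ?w = "\<lambda>g. exp (dF F x0 (g x0) - s * ?d g)"
  define A where "A n = {g \<in> \<Gamma>. real n - 1 \<le> ?d g \<and> ?d g \<le> real n}" for n :: nat
  have fin: "finite (A n)" for n
    by (rule finite_subset[OF _ finite_orbit_ball[OF pd, of x0 "real n"]]) (auto simp: A_def)
  obtain s' where s': "pressure \<Gamma> F x0 < ereal s'" "s' < s"
    using ereal_dense2[OF s] by auto
  define f where "f n = (\<Sum>g\<in>A n. ?w g)" for n
  have f0: "0 \<le> f n" for n unfolding f_def by (simp add: sum_nonneg)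
  have "\<forall>\<^sub>F n in sequentially. (if A n = {} then - \<infinity>
      else ereal (1 / real n * ln (\<Sum>g\<in>A n. exp (dF F x0 (g x0))))) < ereal s'"
    using Limsup_lessD[OF s'(1)[unfolded pressure_def]] by (simp only: A_def Let_def)
  then have "\<forall>\<^sub>F n in sequentially. norm (f n) \<le> exp \<bar>s\<bar> * exp (s' - s) ^ n"
    using eventually_gt_at_top[of 0]
  proof eventually_elim
    case (elim n)
    show ?case
    proof (cases "A n = {}")
      case True
      then show ?thesis by (simp add: f_def)
    next
      case False
      let ?S = "\<Sum>g\<in>A n. exp (dF F x0 (g x0))"
      have "0 < ?S" using False fin by (intro sum_pos) auto
      moreover have "ln ?S < s' * real n"
        using elim False by (simp add: field_simps)
      ultimately have S: "?S \<le> exp (s' * real n)"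
        using ln_ge_iff[of ?S] exp_ln[of ?S] exp_le_cancel_iff[of "ln ?S" "s' * real n"] by linarith
      have "f n \<le> (\<Sum>g\<in>A n. exp (\<bar>s\<bar> - s * real n) * exp (dF F x0 (g x0)))"
        unfolding f_def
      proof (rule sum_mono)
        fix g assume "g \<in> A n"
        \<comment> \<open>The sign of \<open>s\<close> is arbitrary, so replacing the distance by \<open>n\<close> costs \<open>|s|\<close> either way.\<close>
        then have "\<bar>s\<bar> * \<bar>real n - ?d g\<bar> \<le> \<bar>s\<bar> * 1"
          by (intro mult_left_mono) (auto simp: A_def)
        moreover have "s * (real n - ?d g) \<le> \<bar>s\<bar> * \<bar>real n - ?d g\<bar>"
          using abs_ge_self[of "s * (real n - ?d g)"] by (simp only: abs_mult)
        ultimately have "- s * ?d g \<le> \<bar>s\<bar> - s * real n"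
          by (simp add: algebra_simps)
        then show "?w g \<le> exp (\<bar>s\<bar> - s * real n) * exp (dF F x0 (g x0))"
          by (simp flip: exp_add)
      qed
      also have "\<dots> = exp (\<bar>s\<bar> - s * real n) * ?S" by (simp add: sum_distrib_left)
      also have "\<dots> \<le> exp (\<bar>s\<bar> - s * real n) * exp (s' * real n)"
        by (intro mult_left_mono S) simp
      also have "\<dots> = exp \<bar>s\<bar> * exp (s' - s) ^ n"
        unfolding exp_of_nat_mult[symmetric] exp_add[symmetric] by (simp add: algebra_simps)
      finally show ?thesis using f0[of n] by simp
    qed
  qed
  moreover have "summable (\<lambda>n. exp \<bar>s\<bar> * exp (s' - s) ^ n)"
    using s'(2) by (intro summable_mult summable_geometric) simp
  ultimately have f: "summable f" by (rule summable_comparison_test_ev)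
  have "(\<integral>\<^sup>+g. ennreal (?w g) \<partial>count_space \<Gamma>)
      \<le> (\<integral>\<^sup>+g. (\<Sum>n. ennreal (?w g) * indicator (A n) g) \<partial>count_space \<Gamma>)"
  proof (rule nn_integral_mono)
    fix g assume "g \<in> space (count_space \<Gamma>)"
    then have "g \<in> A (nat \<lceil>?d g\<rceil>)"
      unfolding A_def using zero_le_dist[of x0 "g x0"]
      by simp
    then have "ennreal (?w g) = ennreal (?w g) * indicator (A (nat \<lceil>?d g\<rceil>)) g" by simp
    also have "\<dots> \<le> (\<Sum>n. ennreal (?w g) * indicator (A n) g)"
      using sum_le_suminf[of "\<lambda>n. ennreal (?w g) * indicator (A n) g" "{nat \<lceil>?d g\<rceil>}"]
      by (simp only: sum.insert finite.emptyI sum.empty add_0_right empty_iff not_False_eq_True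
        finite.insertI summableI zero_le UNIV_I simp_thms)
    finally show "ennreal (?w g) \<le> (\<Sum>n. ennreal (?w g) * indicator (A n) g)" .
  qed
  also have "\<dots> = (\<Sum>n. \<integral>\<^sup>+g. ennreal (?w g) * indicator (A n) g \<partial>count_space \<Gamma>)"
    by (rule nn_integral_suminf) simp
  also have "\<dots> = (\<Sum>n. ennreal (f n))"
  proof (rule suminf_cong)
    fix n
    have "(\<integral>\<^sup>+g. ennreal (?w g) * indicator (A n) g \<partial>count_space \<Gamma>)
        = (\<Sum>g\<in>A n. ennreal (?w g) * indicator (A n) g)"
      by (rule nn_integral_count_space'[OF fin]) (auto simp: A_def)
    also have "\<dots> = ennreal (f n)" by (simp add: f_def sum_ennreal)
    finally show "(\<integral>\<^sup>+g. ennreal (?w g) * indicator (A n) g \<partial>count_space \<Gamma>) = ennreal (f n)" .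
  qed
  also have "\<dots> = ennreal (\<Sum>n. f n)" by (rule suminf_ennreal2[OF f0 f])
  finally show ?thesis by (rule le_less_trans) simp
qed

section \<open>The inequality between entropy, drift and pressure\<close>

lemma isometry_group_closed:
  assumes "isometry_group \<Gamma>"
  shows "id \<in> \<Gamma>" "\<And>g h. g \<in> \<Gamma> \<Longrightarrow> h \<in> \<Gamma> \<Longrightarrow> g \<circ> h \<in> \<Gamma>"
proof -
  have sub: "subgroup \<Gamma> (BijGroup UNIV)" using assms by (simp add: isometry_group_def)
  have "\<one>\<^bsub>BijGroup UNIV\<^esub> = (id :: 'a \<Rightarrow> 'a)" by (auto simp: BijGroup_def)
  with subgroup.one_closed[OF sub] show "id \<in> \<Gamma>" by simp
  fix g h assume gh: "g \<in> \<Gamma>" "h \<in> \<Gamma>"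
  then have "g \<in> Bij UNIV" "h \<in> Bij UNIV"
    using subgroup.subset[OF sub] by (auto simp: BijGroup_def)
  then have "g \<otimes>\<^bsub>BijGroup UNIV\<^esub> h = g \<circ> h"
    by (auto simp: BijGroup_def compose_def)
  with subgroup.m_closed[OF sub gh] show "g \<circ> h \<in> \<Gamma>" by simp
qed

theorem theorem6p8:
  fixes \<Gamma> :: "('x::heine_borel \<Rightarrow> 'x) set"
    and F :: "(real \<Rightarrow> 'x) set \<Rightarrow> real"
    and \<mu> :: "('x \<Rightarrow> 'x) pmf"
    and x0 :: 'x
    and l l\<^sub>F :: real
  assumes "CAT_minus_one TYPE('x)"
    and "geodesically_complete TYPE('x)"
    and "isometry_group \<Gamma>"
    and "countable \<Gamma>"
    and "non_elementary \<Gamma> x0"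
    and "properly_discontinuous \<Gamma>"
    and "continuous_map unit_tangent_topology euclideanreal F"
    and "invariant_potential \<Gamma> F"
    and "Holder_control F"
    and "pressure \<Gamma> F x0 < \<infinity>"
    and "set_pmf \<mu> \<subseteq> \<Gamma>"
    and "finite_exponential_moment \<mu> x0"
    and "semigroup_generated (set_pmf \<mu>) = \<Gamma>"
    and "is_drift \<mu> x0 l"
    and "is_F_drift F \<mu> x0 l\<^sub>F"
  shows "walk_entropy \<mu> \<le> ereal l * pressure \<Gamma> F x0 - ereal l\<^sub>F"
proof -
  let ?d = "\<lambda>g. dist x0 (g x0)" and ?f = "\<lambda>g. dF F x0 (g x0)"
  note G = \<open>countable \<Gamma>\<close> isometry_group_closed[OF \<open>isometry_group \<Gamma>\<close>]
  have Z: "(\<integral>\<^sup>+g. ennreal (exp (?f g - s * ?d g)) \<partial>count_space \<Gamma>) < \<infinity>"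
    if "pressure \<Gamma> F x0 < ereal s" for s
    using \<open>properly_discontinuous \<Gamma>\<close> that by (rule finite_partition_function)
  obtain s0 where s0: "pressure \<Gamma> F x0 < ereal s0"
    using \<open>pressure \<Gamma> F x0 < \<infinity>\<close> ereal_dense2 by blast
  obtain t where t: "0 < t" "(\<lambda>g. exp (t * ?d g) * pmf \<mu> g) summable_on set_pmf \<mu>"
    using \<open>finite_exponential_moment \<mu> x0\<close> by (auto simp: finite_exponential_moment_def)
  obtain K where K: "\<And>y. \<bar>dF F x0 y\<bar> \<le> K * exp (t * dist x0 y)"
    using dF_exp_bound[OF assms(1,2,9) t(1)] by blast
  have "(\<integral>\<^sup>+g. ennreal (exp (?f g - s0 * ?d g)) \<partial>count_space (set_pmf \<mu>))
      \<le> (\<integral>\<^sup>+g. ennreal (exp (?f g - s0 * ?d g)) \<partial>count_space \<Gamma>)"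
    using \<open>set_pmf \<mu> \<subseteq> \<Gamma>\<close> by (rule nn_integral_count_space_mono_set)
  then have "(\<integral>\<^sup>+g. ennreal (exp (?f g - s0 * ?d g)) \<partial>count_space (set_pmf \<mu>)) < \<infinity>"
    using Z[OF s0] by (rule le_less_trans)
  then have fin: "shannon_entropy \<mu> < \<infinity>"
    using t by (rule finite_shannon_entropy) (use K in auto)
  obtain h where h: "0 \<le> h" "walk_entropy \<mu> = ereal h"
    "(\<lambda>n. enn2real (shannon_entropy (conv_power \<mu> n)) / real n) \<longlonglongrightarrow> h"
    using walk_entropy_is_limit[OF fin] by blast
  have le: "h \<le> s * l - l\<^sub>F" if "pressure \<Gamma> F x0 < ereal s" for s
    using entropy_rate_le[OF G \<open>set_pmf \<mu> \<subseteq> \<Gamma>\<close> fin Z[OF that] _ _ h(3)]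
      \<open>is_drift \<mu> x0 l\<close> \<open>is_F_drift F \<mu> x0 l\<^sub>F\<close>
    by (simp add: is_drift_def is_F_drift_def)
  have "0 \<le> l"
  proof -
    interpret prob_space "iid_increments \<mu>"
      unfolding iid_increments_def by (intro prob_space_PiM measure_pmf.prob_space_axioms)
    have "AE g in iid_increments \<mu>. 0 \<le> l"
      using \<open>is_drift \<mu> x0 l\<close> unfolding is_drift_def
      by eventually_elim (erule LIMSEQ_le_const, simp)
    then show ?thesis by simp
  qed
  show ?thesis
  proof (cases "pressure \<Gamma> F x0")
    case (real v)
    \<comment> \<open>Let \<open>s\<close> decrease to the pressure.\<close>
    have "(\<lambda>k. (v + 1 / real (Suc k)) * l - l\<^sub>F) \<longlonglongrightarrow> v * l - l\<^sub>F"
      by real_asymp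
    then have "h \<le> v * l - l\<^sub>F"
      by (rule LIMSEQ_le_const) (use le real in auto)
    then show ?thesis using h(2) real by (simp add: mult.commute)
  next
    case PInf
    with \<open>pressure \<Gamma> F x0 < \<infinity>\<close> show ?thesis by simp
  next
    case MInf
    \<comment> \<open>If \<open>l > 0\<close>, large negative \<open>s\<close> would make \<open>h\<close> negative; the choice below gives \<open>h \<le> - 1\<close>.
      If \<open>l = 0\<close>, the product of \<open>l\<close> and the pressure is \<open>0\<close>.\<close>
    have "l = 0"
    proof (rule ccontr)
      assume "l \<noteq> 0"
      then have "h \<le> - 1" using le[of "(l\<^sub>F - 1) / l"] MInf by simp
      with h(1) show False by simp
    qed
    then show ?thesis using le[of 0] h(2) MInf by (simp flip: zero_ereal_def)
  qed
qed

end
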